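(* Let $\Omega\subset\mathbb{R}^n$, $n\ge 2$, be a bounded domain, let $a\in C(\Omega)\cap L^\infty(\Omega)$ with $a(x)>0$ in $\Omega$, and let $\lambda>0$. Suppose that $v\in C(\overline{\Omega})$, $v>0$, and $v$ solves $$\Delta_\infty v+\lambda a(x)v^3\le 0\ \text{ in }\Omega.$$ If $\inf_{\partial\Omega}v>0$, and $u\in C(\overline{\Omega})$ solves $$\Delta_\infty u+\lambda a(x)u^3\ge 0\ \text{ in }\Omega,\quad\text{and}\quad u=0\ \text{ on }\partial\Omega,$$ then $u\le 0$ in $\Omega$. If, for $u$, equality holds, i.e. $\Delta_\infty u+\lambda a(x)u^3=0$ in $\Omega$ and $u=0$ on $\partial\Omega$, then $u=0$ in $\Omega$.
   Context: The infinity-Laplacian is $\Delta_\infty u=\sum_{i,j=1}^n \frac{\partial u}{\partial x_i}\frac{\partial u}{\partial x_j}\frac{\partial^2 u}{\partial x_i\partial x_j}$. Differential equations and inequalities are understood in the viscosity sense: for $F\in C(\Omega\times\mathbb{R})$, a function $u\in C(\Omega)$ satisfies $\Delta_\infty u\ge F(x,u)$ in $\Omega$ if, whenever $\psi\in C^2(\Omega)$ and $u-\psi$ has a local maximum at $p\in\Omega$, one has $\Delta_\infty\psi(p)\ge F(p,u(p))$; it satisfies $\Delta_\infty u\le F(x,u)$ in $\Omega$ if, whenever $\psi\in C^2(\Omega)$ and $u-\psi$ has a local minimum at $q\in\Omega$, one has $\Delta_\infty\psi(q)\le F(q,u(q))$; $\Delta_\infty u=F(x,u)$ means both. The inequality $\Delta_\infty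 u+\lambda a(x)u^3\ge 0$ means $\Delta_\infty u\ge-\lambda a(x)u^3$, and similarly for $\le$ and $=$. *)

theory Defs
  imports "HOL-Analysis.Analysis"
begin

definition partial_deriv :: "'n \<Rightarrow> (real^'n::finite \<Rightarrow> real) \<Rightarrow> real^'n \<Rightarrow> real" where
  "partial_deriv i f x = deriv (\<lambda>t. f (x + t *\<^sub>R axis i 1)) 0"

definition has_partial_derivs_on :: "(real^'n::finite \<Rightarrow> real) \<Rightarrow> (real^'n) set \<Rightarrow> bool" where
  "has_partial_derivs_on f S \<longleftrightarrow>
     (\<forall>x\<in>S. \<forall>i. (\<lambda>t. f (x + t *\<^sub>R axis i 1)) differentiable (at 0))"

(* The spaces C^1(S) and C^2(S) for an open set S; values outside S are irrelevant. *)

definition C1_on :: "(real^'n::finite) set \<Rightarrow> (real^'n \<Rightarrow> real) \<Rightarrow> bool" where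
  "C1_on S f \<longleftrightarrow>
     continuous_on S f \<and> has_partial_derivs_on f S \<and> (\<forall>i. continuous_on S (partial_deriv i f))"

definition C2_on :: "(real^'n::finite) set \<Rightarrow> (real^'n \<Rightarrow> real) \<Rightarrow> bool" where
  "C2_on S f \<longleftrightarrow> C1_on S f \<and> (\<forall>i. C1_on S (partial_deriv i f))"

definition infinity_Laplacian :: "(real^'n::finite \<Rightarrow> real) \<Rightarrow> real^'n \<Rightarrow> real" where
  "infinity_Laplacian f x =
     (\<Sum>i\<in>UNIV. \<Sum>j\<in>UNIV.
        partial_deriv i f x * partial_deriv j f x * partial_deriv i (partial_deriv j f) x)"

definition local_max_at :: "(real^'n::finite) set \<Rightarrow> (real^'n \<Rightarrow> real) \<Rightarrow> real^'n \<Rightarrow> bool" where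
  "local_max_at S f p \<longleftrightarrow> p \<in> S \<and> (\<exists>r>0. \<forall>x \<in> S \<inter> ball p r. f x \<le> f p)"

definition local_min_at :: "(real^'n::finite) set \<Rightarrow> (real^'n \<Rightarrow> real) \<Rightarrow> real^'n \<Rightarrow> bool" where
  "local_min_at S f p \<longleftrightarrow> p \<in> S \<and> (\<exists>r>0. \<forall>x \<in> S \<inter> ball p r. f p \<le> f x)"

(* \<Delta>_\<infinity> u \<ge> F(x,u) in S, in the viscosity sense *)
definition viscosity_subsolution ::
  "(real^'n::finite) set \<Rightarrow> (real^'n \<Rightarrow> real \<Rightarrow> real) \<Rightarrow> (real^'n \<Rightarrow> real) \<Rightarrow> bool" where
  "viscosity_subsolution S F u \<longleftrightarrow>
     continuous_on S u \<and>
     (\<forall>\<psi> p. C2_on S \<psi> \<and> local_max_at S (\<lambda>x. u x - \<psi> x) p \<longrightarrow>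
        infinity_Laplacian \<psi> p \<ge> F p (u p))"

(* \<Delta>_\<infinity> u \<le> F(x,u) in S, in the viscosity sense *)
definition viscosity_supersolution ::
  "(real^'n::finite) set \<Rightarrow> (real^'n \<Rightarrow> real \<Rightarrow> real) \<Rightarrow> (real^'n \<Rightarrow> real) \<Rightarrow> bool" where
  "viscosity_supersolution S F u \<longleftrightarrow>
     continuous_on S u \<and>
     (\<forall>\<psi> q. C2_on S \<psi> \<and> local_min_at S (\<lambda>x. u x - \<psi> x) q \<longrightarrow>
        infinity_Laplacian \<psi> q \<le> F q (u q))"

definition viscosity_solution ::
  "(real^'n::finite) set \<Rightarrow> (real^'n \<Rightarrow> real \<Rightarrow> real) \<Rightarrow> (real^'n \<Rightarrow> real) \<Rightarrow> bool" where
  "viscosity_solution S F u \<longleftrightarrow> viscosity_subsolution S F u \<and> viscosity_supersolution S F u"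

(* Membership in L^\<infinity>(S): measurable and bounded almost everywhere. *)
definition Linfty_on :: "(real^'n::finite) set \<Rightarrow> (real^'n \<Rightarrow> real) \<Rightarrow> bool" where
  "Linfty_on S f \<longleftrightarrow>
     f \<in> borel_measurable (lebesgue_on S) \<and> (\<exists>M. AE x in lebesgue_on S. \<bar>f x\<bar> \<le> M)"

end

theory Submission
  imports Defs
begin

text \<open>
  Divide by a positive supersolution and look where the quotient is largest. Put
  \<open>V = v - m\<close> with \<open>2 m\<close> the minimum of \<open>v\<close> over the closed domain. Test functions do not see the
  constant \<open>m\<close>, so \<open>V\<close> satisfies the inequality with right-hand side \<open>- \<lambda> a (V + m)\<^sup>3\<close>: it is still positive,
  and it is a strict supersolution. If \<open>u\<close> were positive somewhere, \<open>u / V\<close> would have a positive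
  maximum, away from the boundary.

  At a maximum point of a quotient of smooth functions the strict inequality would be contradicted at
  once. For viscosity solutions one usually doubles the variables and invokes the theorem on sums.
  The infinity-Laplacian only sees the second derivative along the gradient, and this allows a much
  more elementary route through one-dimensional functions. Maximise \<open>u x / V y\<close> over all pairs with
  \<open>\<bar>x - y\<bar> \<le> 2 r\<close>, let \<open>M\<close> be the maximum, \<open>(x, y)\<close> a maximiser, and \<open>c\<close> its midpoint. Let \<open>h t\<close> be the
  minimum of \<open>V\<close> over the closed ball of radius \<open>t\<close> about \<open>c\<close>. A point of the ball of radius \<open>2 r - t\<close>
  and a point of the ball of radius \<open>t\<close> are at most \<open>2 r\<close> apart, hence
  \<open>u x' \<le> M h (2 r - \<bar>x' - c\<bar>)\<close> in the ball of radius \<open>2 r\<close> about \<open>c\<close>, with equality at \<open>x\<close>.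

  The function \<open>h\<close> inherits the strict supersolution inequality \<open>h'' h'\<^sup>2 \<le> - C\<close> between \<open>0\<close> and \<open>2 r\<close>,
  in the viscosity sense (\<open>h_parabola_test\<close>). Consequently \<open>h\<close> is concave (\<open>h_concave\<close>), so it lies below a line of
  slope \<open>- s < 0\<close> touching it at \<open>r\<close>; and it even lies, near \<open>r\<close>, below every parabola with that slope
  whose curvature \<open>- b < 0\<close> satisfies \<open>b s\<^sup>2 < C\<close> (\<open>h_below_parabola\<close>). Multiplied by \<open>M\<close> and
  composed with \<open>2 r - \<bar>x' - c\<bar>\<close>, such a parabola touches \<open>u\<close> from above at \<open>x\<close>, and the subsolution inequality gives
  \<open>b s\<^sup>2 \<le> \<lambda> a(x) V(y)\<^sup>3\<close>. For small \<open>r\<close> the gain in \<open>(V + m)\<^sup>3\<close> makes \<open>C\<close> larger than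
  \<open>\<lambda> a(x) V(y)\<^sup>3\<close>, so that \<open>b\<close> can be chosen to violate this (\<open>no_touching_at_equidistant_points\<close>).

  If \<open>u\<close> is a solution, then \<open>- u\<close> is a subsolution as well because the cube is odd, and \<open>u\<close> vanishes.
\<close>

section \<open>Radial quartic polynomials as test functions\<close>

text \<open>
  Test functions must be of class $C^2$ on the whole domain, while a function of the distance to \<open>c\<close>
  is in general not smooth at \<open>c\<close>. Polynomials in the squared distance are, and two coefficients
  suffice to prescribe the radial slope and the radial curvature at a given point.
\<close>

definition radial_quartic :: "real^'n::finite \<Rightarrow> real \<Rightarrow> real \<Rightarrow> real^'n \<Rightarrow> real" where
  "radial_quartic c \<beta> \<gamma> x = \<beta> * ((x - c) \<bullet> (x - c)) + \<gamma> * ((x - c) \<bullet> (x - c))\<^sup>2"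

lemma sq_norm_along_axis:
  fixes x c :: "real^'n::finite"
  shows "(x + t *\<^sub>R axis i 1 - c) \<bullet> (x + t *\<^sub>R axis i 1 - c) = (x - c) \<bullet> (x - c) + 2 * t * (x - c) $ i + t\<^sup>2"
proof -
  have "x + t *\<^sub>R axis i 1 - c = (x - c) + t *\<^sub>R axis i 1"
    by simp
  then show ?thesis
    by (simp add: inner_add_left inner_add_right inner_axis inner_axis' inner_axis_axis
        power2_eq_square algebra_simps)
qed

lemma radial_quartic_deriv:
  fixes x c :: "real^'n::finite"
  shows "((\<lambda>t. radial_quartic c \<beta> \<gamma> (x + t *\<^sub>R axis i 1)) has_field_derivative
           2 * (x - c) $ i * (\<beta> + 2 * \<gamma> * ((x - c) \<bullet> (x - c)))) (at 0)"
  unfolding radial_quartic_def sq_norm_along_axis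
  by (auto intro!: derivative_eq_intros simp: algebra_simps)

lemma partial_deriv_radial_quartic:
  fixes c :: "real^'n::finite"
  shows "partial_deriv i (radial_quartic c \<beta> \<gamma>) =
         (\<lambda>x. 2 * (x - c) $ i * (\<beta> + 2 * \<gamma> * ((x - c) \<bullet> (x - c))))"
  unfolding partial_deriv_def using DERIV_imp_deriv[OF radial_quartic_deriv] by blast

lemma radial_quartic_deriv2:
  fixes x c :: "real^'n::finite"
  shows "((\<lambda>t. partial_deriv i (radial_quartic c \<beta> \<gamma>) (x + t *\<^sub>R axis j 1)) has_field_derivative
           (if i = j then 2 * (\<beta> + 2 * \<gamma> * ((x - c) \<bullet> (x - c))) else 0)
             + 8 * \<gamma> * (x - c) $ i * (x - c) $ j) (at 0)"
proof -
  have "(x + t *\<^sub>R axis j 1 - c) $ i = (x - c) $ i + (if i = j then t else 0)" for t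
    by (auto simp: axis_def)
  then show ?thesis
    unfolding partial_deriv_radial_quartic sq_norm_along_axis
    by (auto intro!: derivative_eq_intros simp: algebra_simps)
qed

lemma partial_deriv2_radial_quartic:
  fixes c :: "real^'n::finite"
  shows "partial_deriv j (partial_deriv i (radial_quartic c \<beta> \<gamma>)) =
         (\<lambda>x. (if i = j then 2 * (\<beta> + 2 * \<gamma> * ((x - c) \<bullet> (x - c))) else 0)
             + 8 * \<gamma> * (x - c) $ i * (x - c) $ j)"
  unfolding partial_deriv_def[of j] using DERIV_imp_deriv[OF radial_quartic_deriv2] by blast

lemma C2_on_radial_quartic: "C2_on S (radial_quartic c \<beta> \<gamma>)"
proof -
  have 0: "continuous_on S (radial_quartic c \<beta> \<gamma>)"
    unfolding radial_quartic_def by (intro continuous_intros)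
  have 1: "continuous_on S (partial_deriv i (radial_quartic c \<beta> \<gamma>))" for i
    unfolding partial_deriv_radial_quartic by (intro continuous_intros)
  have 2: "continuous_on S (partial_deriv j (partial_deriv i (radial_quartic c \<beta> \<gamma>)))" for i j
    unfolding partial_deriv2_radial_quartic
    by (cases "i = j") (auto intro!: continuous_intros)
  show ?thesis
    unfolding C2_on_def C1_on_def has_partial_derivs_on_def
    unfolding real_differentiable_def
    using 0 1 2 radial_quartic_deriv radial_quartic_deriv2 by blast
qed

text \<open>
  With \<open>f t = \<beta> t\<^sup>2 + \<gamma> t\<^sup>4\<close> the value is \<open>f'(t)\<^sup>2 f''(t)\<close> at the distance \<open>t\<close>: the gradient is radial, and so
  only the radial second derivative contributes.
\<close>

lemma infinity_Laplacian_radial_quartic: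
  fixes c :: "real^'n::finite"
  shows "infinity_Laplacian (radial_quartic c \<beta> \<gamma>) x =
    (2 * \<beta> * dist c x + 4 * \<gamma> * dist c x ^ 3)\<^sup>2 * (2 * \<beta> + 12 * \<gamma> * (dist c x)\<^sup>2)"
proof -
  define X where "X = x - c"
  define R where "R = X \<bullet> X"
  define B where "B = \<beta> + 2 * \<gamma> * R"
  have R: "R = (\<Sum>i\<in>UNIV. X $ i * X $ i)"
    by (simp add: R_def inner_vec_def)
  have Rd: "R = (dist c x)\<^sup>2"
    by (simp add: R_def X_def dist_norm norm_minus_commute dot_square_norm)
  have "infinity_Laplacian (radial_quartic c \<beta> \<gamma>) x =
     (\<Sum>i\<in>UNIV. \<Sum>j\<in>UNIV. 2 * X $ i * B * (2 * X $ j * B) *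
          ((if j = i then 2 * B else 0) + 8 * \<gamma> * X $ j * X $ i))"
    unfolding infinity_Laplacian_def partial_deriv2_radial_quartic
    unfolding partial_deriv_radial_quartic
    by (simp only: X_def R_def B_def)
  also have "\<dots> = (\<Sum>i\<in>UNIV. \<Sum>j\<in>UNIV. (if j = i then 8 * B^3 * (X $ i * X $ j) else 0)
        + 32 * \<gamma> * B\<^sup>2 * ((X $ i * X $ i) * (X $ j * X $ j)))"
    by (intro sum.cong refl) (auto simp: algebra_simps power2_eq_square power3_eq_cube)
  also have "\<dots> = 8 * B^3 * R + 32 * \<gamma> * B\<^sup>2 * (R * R)"
    by (simp add: sum.distrib flip: sum_distrib_left sum_distrib_right R)
  also have "\<dots> = 4 * B\<^sup>2 * R * (2 * B + 8 * \<gamma> * R)"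
    by (simp add: algebra_simps power2_eq_square power3_eq_cube)
  also have "\<dots> = (2 * \<beta> * dist c x + 4 * \<gamma> * dist c x ^ 3)\<^sup>2 * (2 * \<beta> + 12 * \<gamma> * (dist c x)\<^sup>2)"
    by (simp add: B_def Rd algebra_simps power2_eq_square power3_eq_cube)
  finally show ?thesis .
qed

text \<open>
  The quartic with slope \<open>s\<close> and curvature \<open>b + \<eta>\<close> at \<open>\<tau>\<close> exceeds the parabola with slope \<open>s\<close> and
  curvature \<open>b\<close> by \<open>(t - \<tau>)\<^sup>2 (\<eta> / 2 + O(t - \<tau>))\<close>. This reduces tests with parabolas in the distance
  to tests with smooth functions, at the price of an arbitrarily small \<open>\<eta>\<close>.
\<close>

lemma quartic_above_parabola:
  fixes \<tau> s b \<eta> :: real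
  assumes "\<tau> > 0" "\<eta> > 0"
  shows "\<exists>\<beta> \<gamma> \<delta>. 2 * \<beta> * \<tau> + 4 * \<gamma> * \<tau> ^ 3 = s \<and> 2 * \<beta> + 12 * \<gamma> * \<tau>\<^sup>2 = b + \<eta> \<and> \<delta> > 0 \<and>
    (\<forall>t. \<bar>t - \<tau>\<bar> < \<delta> \<longrightarrow>
       s * (t - \<tau>) + b / 2 * (t - \<tau>)\<^sup>2 \<le> (\<beta> * t\<^sup>2 + \<gamma> * (t\<^sup>2)\<^sup>2) - (\<beta> * \<tau>\<^sup>2 + \<gamma> * (\<tau>\<^sup>2)\<^sup>2))"
proof -
  define \<gamma> where "\<gamma> = (b + \<eta> - s / \<tau>) / (8 * \<tau>\<^sup>2)"
  define \<beta> where "\<beta> = (s / \<tau> - 4 * \<gamma> * \<tau>\<^sup>2) / 2"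
  have "8 * \<gamma> * \<tau>\<^sup>2 = b + \<eta> - s / \<tau>" "2 * \<beta> = s / \<tau> - 4 * \<gamma> * \<tau>\<^sup>2"
    using assms by (simp_all add: \<gamma>_def \<beta>_def)
  then have 2: "2 * \<beta> + 12 * \<gamma> * \<tau>\<^sup>2 = b + \<eta>" and "(2 * \<beta> + 4 * \<gamma> * \<tau>\<^sup>2) * \<tau> = s"
    using assms by simp_all
  then have 1: "2 * \<beta> * \<tau> + 4 * \<gamma> * \<tau> ^ 3 = s"
    by (simp add: algebra_simps power2_eq_square power3_eq_cube)
  have lim: "((\<lambda>t. \<eta> / 2 + \<gamma> * (t - \<tau>) * (4 * \<tau> + (t - \<tau>))) \<longlongrightarrow> \<eta> / 2 + \<gamma> * (\<tau> - \<tau>) * (4 * \<tau> + (\<tau> - \<tau>))) (nhds \<tau>)"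
    by (intro tendsto_intros filterlim_ident)
  then have "\<forall>\<^sub>F t in nhds \<tau>. \<eta> / 2 + \<gamma> * (t - \<tau>) * (4 * \<tau> + (t - \<tau>)) > 0"
    using order_tendstoD(1)[OF lim, of 0] assms by simp
  then obtain \<delta> where \<delta>: "\<delta> > 0" "\<And>t. dist t \<tau> < \<delta> \<Longrightarrow> \<eta> / 2 + \<gamma> * (t - \<tau>) * (4 * \<tau> + (t - \<tau>)) > 0"
    unfolding eventually_nhds_metric by auto
  show ?thesis
  proof (intro exI[of _ \<beta>] exI[of _ \<gamma>] exI[of _ \<delta>] conjI allI impI, fact 1, fact 2, fact \<delta>(1))
    fix t assume "\<bar>t - \<tau>\<bar> < \<delta>"
    then have "\<eta> / 2 + \<gamma> * (t - \<tau>) * (4 * \<tau> + (t - \<tau>)) > 0"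
      using \<delta>(2) by (simp add: dist_real_def)
    then have "0 \<le> (t - \<tau>)\<^sup>2 * (\<eta> / 2 + \<gamma> * (t - \<tau>) * (4 * \<tau> + (t - \<tau>)))"
      by simp
    also have "\<dots> = (\<beta> * t\<^sup>2 + \<gamma> * (t\<^sup>2)\<^sup>2) - (\<beta> * \<tau>\<^sup>2 + \<gamma> * (\<tau>\<^sup>2)\<^sup>2)
        - (2 * \<beta> * \<tau> + 4 * \<gamma> * \<tau> ^ 3) * (t - \<tau>) - (2 * \<beta> + 12 * \<gamma> * \<tau>\<^sup>2 - \<eta>) / 2 * (t - \<tau>)\<^sup>2"
      by (simp add: field_simps power2_eq_square power3_eq_cube)
    finally have "0 \<le> (\<beta> * t\<^sup>2 + \<gamma> * (t\<^sup>2)\<^sup>2) - (\<beta> * \<tau>\<^sup>2 + \<gamma> * (\<tau>\<^sup>2)\<^sup>2)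
        - s * (t - \<tau>) - (b + \<eta> - \<eta>) / 2 * (t - \<tau>)\<^sup>2"
      unfolding 1 2 .
    then show "s * (t - \<tau>) + b / 2 * (t - \<tau>)\<^sup>2 \<le> (\<beta> * t\<^sup>2 + \<gamma> * (t\<^sup>2)\<^sup>2) - (\<beta> * \<tau>\<^sup>2 + \<gamma> * (\<tau>\<^sup>2)\<^sup>2)"
      by simp
  qed
qed

section \<open>Viscosity inequalities tested on functions of the distance\<close>

definition radial_parabola :: "real^'n::finite \<Rightarrow> real^'n \<Rightarrow> real \<Rightarrow> real \<Rightarrow> real^'n \<Rightarrow> real" where
  "radial_parabola c p s b x = s * (dist c x - dist c p) + b / 2 * (dist c x - dist c p)\<^sup>2"

text \<open>
  The restriction of the viscosity inequality to test functions \<open>s \<xi> + b \<xi>\<^sup>2 / 2\<close> in the deviation \<open>\<xi>\<close> of the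
  distance to some \<open>c \<noteq> p\<close> from its value at the test point \<open>p\<close>, for which the infinity-Laplacian at \<open>p\<close> is
  \<open>s\<^sup>2 b\<close>. The right-hand side \<open>G\<close> is a function of the point alone, so that the notion does not
  change when a constant is added to the tested function.
\<close>

definition radial_subsolution :: "(real^'n::finite) set \<Rightarrow> (real^'n \<Rightarrow> real) \<Rightarrow> (real^'n \<Rightarrow> real) \<Rightarrow> bool" where
  "radial_subsolution S G u \<longleftrightarrow>
     (\<forall>c p s b. c \<noteq> p \<and> local_max_at S (\<lambda>x. u x - radial_parabola c p s b x) p \<longrightarrow> G p \<le> s\<^sup>2 * b)"

definition radial_supersolution :: "(real^'n::finite) set \<Rightarrow> (real^'n \<Rightarrow> real) \<Rightarrow> (real^'n \<Rightarrow> real) \<Rightarrow> bool" where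
  "radial_supersolution S G v \<longleftrightarrow>
     (\<forall>c p s b. c \<noteq> p \<and> local_min_at S (\<lambda>x. v x - radial_parabola c p s b x) p \<longrightarrow> s\<^sup>2 * b \<le> G p)"

lemma radial_parabola_uminus: "radial_parabola c p (- s) (- b) x = - radial_parabola c p s b x"
  by (simp add: radial_parabola_def)

lemma local_max_at_uminus: "local_max_at S (\<lambda>x. - f x) p \<longleftrightarrow> local_min_at S f p"
  by (simp add: local_max_at_def local_min_at_def)

lemma radial_subsolution_uminus:
  "radial_subsolution S (\<lambda>x. - G x) (\<lambda>x. - v x) \<longleftrightarrow> radial_supersolution S G v"
proof -
  have *: "local_max_at S (\<lambda>x. - v x - radial_parabola c p (- s) (- b) x) p \<longleftrightarrow>
        local_min_at S (\<lambda>x. v x - radial_parabola c p s b x) p" for c p s b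
    by (simp add: radial_parabola_uminus flip: local_max_at_uminus)
  show ?thesis
  proof
    assume sub: "radial_subsolution S (\<lambda>x. - G x) (\<lambda>x. - v x)"
    show "radial_supersolution S G v"
      unfolding radial_supersolution_def
    proof (intro allI impI)
      fix c p s b assume "c \<noteq> p \<and> local_min_at S (\<lambda>x. v x - radial_parabola c p s b x) p"
      then have "- G p \<le> (- s)\<^sup>2 * (- b)"
        using sub * unfolding radial_subsolution_def by blast
      then show "s\<^sup>2 * b \<le> G p" by simp
    qed
  next
    assume "radial_supersolution S G v"
    then have "s\<^sup>2 * b \<le> G p" if "c \<noteq> p" "local_max_at S (\<lambda>x. - v x - radial_parabola c p (- s) (- b) x) p" for c p s b
      using * that unfolding radial_supersolution_def by blast
    from this[of _ _ "- s" "- b" for s b]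
    show "radial_subsolution S (\<lambda>x. - G x) (\<lambda>x. - v x)"
      unfolding radial_subsolution_def by fastforce
  qed
qed

lemma quartic_tests_imp_radial_subsolution:
  fixes S :: "(real^'n::finite) set"
  assumes test: "\<And>c \<beta> \<gamma> p. local_max_at S (\<lambda>x. u x - radial_quartic c \<beta> \<gamma> x) p \<Longrightarrow>
                   G p \<le> infinity_Laplacian (radial_quartic c \<beta> \<gamma>) p"
  shows "radial_subsolution S G u"
  unfolding radial_subsolution_def
proof (intro allI impI, elim conjE)
  fix c p s b
  assume "c \<noteq> p" and max: "local_max_at S (\<lambda>x. u x - radial_parabola c p s b x) p"
  from max obtain r where r: "p \<in> S" "r > 0"
    "\<And>x. x \<in> S \<inter> ball p r \<Longrightarrow> u x - radial_parabola c p s b x \<le> u p - radial_parabola c p s b p"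
    unfolding local_max_at_def by blast
  have "G p \<le> s\<^sup>2 * b + s\<^sup>2 * \<eta>" if "\<eta> > 0" for \<eta>
  proof -
    have "dist c p > 0"
      using \<open>c \<noteq> p\<close> by simp
    then obtain \<beta> \<gamma> \<delta> where q: "2 * \<beta> * dist c p + 4 * \<gamma> * dist c p ^ 3 = s"
      "2 * \<beta> + 12 * \<gamma> * (dist c p)\<^sup>2 = b + \<eta>" "\<delta> > 0"
      "\<And>t. \<bar>t - dist c p\<bar> < \<delta> \<Longrightarrow> s * (t - dist c p) + b / 2 * (t - dist c p)\<^sup>2
          \<le> (\<beta> * t\<^sup>2 + \<gamma> * (t\<^sup>2)\<^sup>2) - (\<beta> * (dist c p)\<^sup>2 + \<gamma> * ((dist c p)\<^sup>2)\<^sup>2)"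
      by (metis quartic_above_parabola[OF _ \<open>\<eta> > 0\<close>])
    have rq: "radial_quartic c \<beta> \<gamma> x = \<beta> * (dist c x)\<^sup>2 + \<gamma> * ((dist c x)\<^sup>2)\<^sup>2" for x
      by (simp add: radial_quartic_def dist_norm norm_minus_commute dot_square_norm)
    have "local_max_at S (\<lambda>x. u x - radial_quartic c \<beta> \<gamma> x) p"
      unfolding local_max_at_def
    proof (intro conjI exI[of _ "min r \<delta>"] ballI)
      fix x assume x: "x \<in> S \<inter> ball p (min r \<delta>)"
      then have "dist p x < \<delta>" "x \<in> S \<inter> ball p r" by auto
      moreover have "\<bar>dist c x - dist c p\<bar> \<le> dist p x"
        by (smt (verit) dist_commute dist_triangle)
      ultimately show "u x - radial_quartic c \<beta> \<gamma> x \<le> u p - radial_quartic c \<beta> \<gamma> p"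
        using r(3)[of x] q(4)[of "dist c x"] unfolding rq by (simp add: radial_parabola_def)
    qed (use r q in auto)
    from test[OF this] show ?thesis
      unfolding infinity_Laplacian_radial_quartic q(1,2) by (simp add: algebra_simps)
  qed
  note le = this
  show "G p \<le> s\<^sup>2 * b"
  proof (rule field_le_epsilon)
    fix e :: real assume "e > 0"
    have pos: "s\<^sup>2 + 1 > 0"
      by (simp add: add_nonneg_pos)
    (* The denominator is shifted by 1 because the slope may vanish. *)
    have "G p \<le> s\<^sup>2 * b + s\<^sup>2 * (e / (s\<^sup>2 + 1))"
      using \<open>e > 0\<close> by (intro le) (auto simp: add_nonneg_pos)
    also have "s\<^sup>2 * (e / (s\<^sup>2 + 1)) \<le> e"
      using \<open>e > 0\<close> pos by (simp add: pos_divide_le_eq distrib_left)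
    finally show "G p \<le> s\<^sup>2 * b + e" by simp
  qed
qed

lemma viscosity_subsolution_imp_radial:
  assumes "viscosity_subsolution S F u"
  shows "radial_subsolution S (\<lambda>x. F x (u x)) u"
  using assms C2_on_radial_quartic unfolding viscosity_subsolution_def
  by (intro quartic_tests_imp_radial_subsolution) blast

lemma viscosity_supersolution_imp_radial:
  assumes "viscosity_supersolution S F v"
  shows "radial_supersolution S (\<lambda>x. F x (v x)) v"
  unfolding radial_subsolution_uminus[symmetric]
proof (rule quartic_tests_imp_radial_subsolution)
  fix c \<beta> \<gamma> p assume "local_max_at S (\<lambda>x. - v x - radial_quartic c \<beta> \<gamma> x) p"
  then have "local_min_at S (\<lambda>x. v x - radial_quartic c (- \<beta>) (- \<gamma>) x) p"
    unfolding local_max_at_uminus[symmetric] by (simp add: radial_quartic_def algebra_simps)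
  then have "infinity_Laplacian (radial_quartic c (- \<beta>) (- \<gamma>)) p \<le> F p (v p)"
    using assms C2_on_radial_quartic unfolding viscosity_supersolution_def by blast
  moreover have "infinity_Laplacian (radial_quartic c (- \<beta>) (- \<gamma>)) p = - infinity_Laplacian (radial_quartic c \<beta> \<gamma>) p"
    unfolding infinity_Laplacian_radial_quartic by (simp add: algebra_simps power2_eq_square)
  ultimately show "- F p (v p) \<le> infinity_Laplacian (radial_quartic c \<beta> \<gamma>) p"
    by simp
qed

section \<open>Minima of a strict supersolution over concentric balls\<close>

definition ball_min :: "('a::metric_space \<Rightarrow> real) \<Rightarrow> 'a \<Rightarrow> real \<Rightarrow> real" where
  "ball_min v c t = (INF y\<in>cball c t. v y)"

lemma ball_min_eqI:
  assumes "y \<in> cball c t" "\<And>z. z \<in> cball c t \<Longrightarrow> v y \<le> v z"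
  shows "ball_min v c t = v y"
  unfolding ball_min_def using assms by (intro cInf_eq_minimum) auto

text \<open>
  In the application \<open>- G\<close> is \<open>\<lambda> a (V + m)\<^sup>3\<close>, a positive continuous function on the domain, so that it is at least
  some \<open>C > 0\<close> on a compact ball.
\<close>

locale strict_radial_supersolution =
  fixes S :: "(real^'n::finite) set" and G v :: "real^'n \<Rightarrow> real" and c :: "real^'n" and d C :: real
  assumes super: "radial_supersolution S G v"
    and cball_subset: "cball c d \<subseteq> S"
    and continuous: "continuous_on (cball c d) v"
    and C_pos: "C > 0"
    and strict: "\<And>y. y \<in> cball c d \<Longrightarrow> G y \<le> - C"
begin

abbreviation h :: "real \<Rightarrow> real" where "h \<equiv> ball_min v c"

lemma h_attained:
  assumes "t \<in> {0..d}"
  obtains y where "y \<in> cball c t" "h t = v y"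
proof -
  have "continuous_on (cball c t) v"
    using continuous assms by (rule_tac continuous_on_subset) auto
  then obtain y where "y \<in> cball c t" "\<forall>z\<in>cball c t. v y \<le> v z"
    using continuous_attains_inf[of "cball c t" v] assms by auto
  then show ?thesis
    using that ball_min_eqI by blast
qed

lemma h_le: "t \<in> {0..d} \<Longrightarrow> z \<in> cball c t \<Longrightarrow> h t \<le> v z"
proof -
  assume t: "t \<in> {0..d}" and z: "z \<in> cball c t"
  have "compact (v ` cball c t)"
    using continuous t by (intro compact_continuous_image continuous_on_subset[OF continuous]) auto
  then have "bdd_below (v ` cball c t)"
    by (intro bounded_imp_bdd_below compact_imp_bounded)
  then show "h t \<le> v z"
    unfolding ball_min_def using z by (rule cINF_lower)
qed

text \<open>
  A minimiser in the interior of the ball would be a local minimum of \<open>v\<close>, where the constant test function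
  contradicts the strict negativity of \<open>G\<close>.
\<close>

lemma minimizer_on_sphere:
  assumes "t \<in> {0..d}" "y \<in> cball c t" "v y = h t"
  shows "dist c y = t"
proof (rule ccontr)
  assume "dist c y \<noteq> t"
  then have "dist c y < t"
    using assms by simp
  (* A radial parabola needs a centre different from the test point; as this one is the
  zero function, any centre will do. *)
  define e :: "real^'n" where "e = y + axis undefined 1"
  have "e \<noteq> y"
    by (simp add: e_def)
  have "y \<in> S"
    using assms cball_subset by auto
  have "local_min_at S (\<lambda>x. v x - radial_parabola e y 0 0 x) y"
    unfolding local_min_at_def
  proof (intro conjI exI[of _ "t - dist c y"] ballI)
    fix x assume "x \<in> S \<inter> ball y (t - dist c y)"
    then have "dist c x \<le> t"
      using dist_triangle[of c x y] by (simp add: dist_commute)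
    then show "v y - radial_parabola e y 0 0 y \<le> v x - radial_parabola e y 0 0 x"
      using h_le[of t x] assms by (simp add: radial_parabola_def)
  qed (use \<open>y \<in> S\<close> \<open>dist c y < t\<close> in auto)
  then have "0\<^sup>2 * 0 \<le> G y"
    using super \<open>e \<noteq> y\<close> unfolding radial_supersolution_def by blast
  with strict[of y] C_pos show False
    using assms by auto
qed

text \<open>
  The one-dimensional inequality \<open>h'' h'\<^sup>2 \<le> - C\<close> in the viscosity sense. A parabola touching \<open>h\<close> from
  below at \<open>\<tau>\<close> becomes, as a function of the distance to \<open>c\<close>, a test function touching \<open>v\<close> from below at
  a minimiser over the ball of radius \<open>\<tau>\<close>. It matters here that the minimiser lies on the sphere,
  where the distance equals \<open>\<tau>\<close>.
\<close>

lemma h_parabola_test: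
  assumes t: "t1 < \<tau>" "\<tau> < t2" "0 \<le> t1" "t2 \<le> d"
    and below: "\<And>t. t \<in> {t1..t2} \<Longrightarrow> h \<tau> + s * (t - \<tau>) + b / 2 * (t - \<tau>)\<^sup>2 \<le> h t"
  shows "s\<^sup>2 * b \<le> - C"
proof -
  obtain y where y: "y \<in> cball c \<tau>" "h \<tau> = v y"
    using h_attained[of \<tau>] t by auto
  then have d: "dist c y = \<tau>"
    using minimizer_on_sphere[of \<tau> y] t by auto
  have "y \<in> cball c d" and "c \<noteq> y"
    using d t by auto
  have "local_min_at S (\<lambda>x. v x - radial_parabola c y s b x) y"
    unfolding local_min_at_def
  proof (intro conjI exI[of _ "min (\<tau> - t1) (t2 - \<tau>)"] ballI)
    fix x assume "x \<in> S \<inter> ball y (min (\<tau> - t1) (t2 - \<tau>))"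
    then have "\<bar>dist c x - \<tau>\<bar> \<le> min (\<tau> - t1) (t2 - \<tau>)"
      using d dist_triangle[of c x y] dist_triangle[of c y x] by (simp add: dist_commute abs_le_iff)
    then have in_interval: "dist c x \<in> {t1..t2}"
      by auto
    then have "h (dist c x) \<le> v x"
      using t by (intro h_le) auto
    with below[OF in_interval]
    show "v y - radial_parabola c y s b y \<le> v x - radial_parabola c y s b x"
      unfolding radial_parabola_def d y(2)[symmetric] by simp
  qed (use \<open>y \<in> cball c d\<close> cball_subset t in auto)
  then have "s\<^sup>2 * b \<le> G y"
    using super \<open>c \<noteq> y\<close> unfolding radial_supersolution_def by blast
  with strict[OF \<open>y \<in> cball c d\<close>] show ?thesis
    by simp
qed

text \<open>
  Writing the points of the ball of radius \<open>t\<close> as \<open>c + t z\<close> with \<open>\<bar>z\<bar> \<le> 1\<close> turns the two nested minima, over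
  the ball and over \<open>t\<close>, into one of a continuous function over a compact set of pairs \<open>(t, z)\<close>.
\<close>

lemma h_minus_continuous_attains_inf:
  assumes "t1 \<le> t2" "0 \<le> t1" "t2 \<le> d" "continuous_on {t1..t2} q"
  obtains \<tau> where "\<tau> \<in> {t1..t2}" "\<And>t. t \<in> {t1..t2} \<Longrightarrow> h \<tau> - q \<tau> \<le> h t - q t"
proof -
  have sub: "(\<lambda>p. c + fst p *\<^sub>R snd p) ` ({t1..t2} \<times> cball 0 1) \<subseteq> cball c d"
  proof (rule image_subsetI)
    fix p :: "real \<times> (real^'n)" assume "p \<in> {t1..t2} \<times> cball 0 1"
    then have p: "t1 \<le> fst p" "fst p \<le> t2" "norm (snd p) \<le> 1"
      by auto
    then have "fst p * norm (snd p) \<le> fst p"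
      using assms mult_left_le[of "norm (snd p)" "fst p"] by simp
    then show "c + fst p *\<^sub>R snd p \<in> cball c d"
      using p assms by (simp add: dist_norm)
  qed
  define K where "K = {t1..t2} \<times> cball (0::real^'n) 1"
  define f where "f p = v (c + fst p *\<^sub>R snd p) - q (fst p)" for p
  have "compact K"
    unfolding K_def by (intro compact_Times) auto
  have "continuous_on K (\<lambda>p. v (c + fst p *\<^sub>R snd p))"
    unfolding K_def by (rule continuous_on_compose2[OF continuous _ sub]) (intro continuous_intros)
  then have "continuous_on K f"
    unfolding f_def K_def
    by (intro continuous_on_diff continuous_on_compose2[OF assms(4)] continuous_on_fst continuous_on_id) auto
  moreover have "K \<noteq> {}"
    using assms by (simp add: K_def)
  ultimately have "\<exists>p\<in>K. \<forall>p'\<in>K. f p \<le> f p'"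
    by (intro continuous_attains_inf[OF \<open>compact K\<close>])
  then obtain p where "p \<in> K" and p: "\<And>p'. p' \<in> K \<Longrightarrow> f p \<le> f p'"
    by blast
  then obtain \<tau> z where z: "\<tau> \<in> {t1..t2}" "norm z \<le> 1" "p = (\<tau>, z)"
    unfolding K_def by (cases p) auto
  have "h \<tau> - q \<tau> \<le> h t - q t" if t: "t \<in> {t1..t2}" for t
  proof -
    obtain y where y: "y \<in> cball c t" "h t = v y"
      using h_attained[of t] t assms by auto
    define w where "w = (y - c) /\<^sub>R t"
    have "norm (y - c) \<le> t"
      using y(1) by (simp add: dist_norm norm_minus_commute)
    moreover have "t \<ge> 0"
      using t assms by simp
    ultimately have w: "norm w \<le> 1" "c + t *\<^sub>R w = y"
      by (cases "t = 0"; simp add: w_def divide_inverse_commute[symmetric] divide_le_eq)+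
    have "dist c (c + \<tau> *\<^sub>R z) \<le> \<tau>"
      using z assms mult_left_le[of "norm z" \<tau>] by (simp add: dist_norm)
    then have "h \<tau> \<le> v (c + \<tau> *\<^sub>R z)"
      using z assms by (intro h_le) auto
    then show ?thesis
      using p[of "(t, w)"] z(3) w t y(2) by (simp add: K_def f_def)
  qed
  with z(1) that show ?thesis by blast
qed

text \<open>
  If \<open>h\<close> drops below a parabola that it dominates at both ends of an interval, then a vertical translate of the
  parabola touches \<open>h\<close> from below in the interior.
\<close>

lemma h_not_below_parabola:
  assumes "t1 < t2" "0 \<le> t1" "t2 \<le> d"
    and "\<sigma> \<in> {t1<..<t2}" "h \<sigma> < q \<sigma>" "q t1 \<le> h t1" "q t2 \<le> h t2"
    and q: "\<And>t. q t = e + s * t + b / 2 * t\<^sup>2"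
  obtains \<tau> where "\<tau> \<in> {t1<..<t2}" "(s + b * \<tau>)\<^sup>2 * b \<le> - C"
proof -
  have "continuous_on {t1..t2} q"
    unfolding q by (intro continuous_intros)
  then obtain \<tau> where \<tau>: "\<tau> \<in> {t1..t2}" "\<And>t. t \<in> {t1..t2} \<Longrightarrow> h \<tau> - q \<tau> \<le> h t - q t"
    using h_minus_continuous_attains_inf[of t1 t2 q] assms by auto
  have "h \<tau> - q \<tau> < 0"
    using \<tau>(2)[of \<sigma>] assms by auto
  then have "\<tau> \<noteq> t1" "\<tau> \<noteq> t2"
    using assms by auto
  with \<tau>(1) have in_open: "\<tau> \<in> {t1<..<t2}"
    by auto
  moreover have "(s + b * \<tau>)\<^sup>2 * b \<le> - C"
  proof (rule h_parabola_test[of t1 \<tau> t2])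
    fix t assume "t \<in> {t1..t2}"
    from \<tau>(2)[OF this] show "h \<tau> + (s + b * \<tau>) * (t - \<tau>) + b / 2 * (t - \<tau>)\<^sup>2 \<le> h t"
      unfolding q by (simp add: field_simps power2_eq_square)
  qed (use in_open assms in auto)
  ultimately show ?thesis
    using that by blast
qed

text \<open>
  Otherwise \<open>h\<close> would drop below one of its chords, and the test with \<open>b = 0\<close> would give \<open>0 \<le> - C\<close>.
\<close>

lemma h_concave: "concave_on {0..d} h"
  unfolding concave_on_def
proof (rule convex_on_linorderI)
  fix t x y :: real
  assume t: "0 < t" "t < 1" and xy: "x \<in> {0..d}" "y \<in> {0..d}" "x < y"
  define m where "m = (h y - h x) / (y - x)"
  define q where "q s = (h x - m * x) + m * s + 0 / 2 * s\<^sup>2" for s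
  define \<sigma> where "\<sigma> = (1 - t) *\<^sub>R x + t *\<^sub>R y"
  have \<sigma>: "\<sigma> = x + t * (y - x)"
    by (simp add: \<sigma>_def algebra_simps)
  have my: "m * (y - x) = h y - h x"
    using xy by (simp add: m_def)
  have "\<not> h \<sigma> < q \<sigma>"
  proof
    assume "h \<sigma> < q \<sigma>"
    moreover have "\<sigma> \<in> {x<..<y}"
      using t xy by (auto simp: \<sigma> intro!: mult_pos_pos) (smt (verit) mult_less_cancel_right2)
    ultimately show False
      using h_not_below_parabola[of x y \<sigma> q "h x - m * x" m 0] xy C_pos my
      by (auto simp: q_def algebra_simps)
  qed
  moreover have "q \<sigma> = h x + t * (m * (y - x))"
    by (simp add: q_def \<sigma> algebra_simps)
  ultimately show "- h \<sigma> \<le> (1 - t) * - h x + t * - h y"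
    unfolding my by (simp add: algebra_simps)
qed auto

text \<open>
  The slope of a supporting line is strictly negative because the minimum over a smaller ball is strictly
  larger, its minimisers not being on the larger sphere.
\<close>

lemma h_strict_decreasing_supergradient:
  assumes "0 < r" "r < d"
  obtains s where "s > 0" "\<And>t. t \<in> {0..d} \<Longrightarrow> h t \<le> h r - s * (t - r)"
proof -
  (* This is the right derivative of - h at r, the slope of a supporting line of the convex function - h. *)
  define s where "s = Inf ((\<lambda>t. (- h r - - h t) / (r - t)) ` ({r<..} \<inter> {0..d}))"
  have s: "h t \<le> h r - s * (t - r)" if "t \<in> {0..d}" for t
    using convex_le_Inf_differential[OF h_concave[unfolded concave_on_def], of r t] assms that
    by (simp add: s_def interior_atLeastAtMost_real)
  obtain y where y: "y \<in> cball c (r / 2)" "h (r / 2) = v y"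
    using h_attained[of "r/2"] assms by auto
  have "dist c y \<noteq> r" "y \<in> cball c r"
    using y(1) assms by auto
  then have "h (r / 2) > h r"
    using minimizer_on_sphere[of r y] h_le[of r y] y assms by force
  also have "h (r / 2) \<le> h r + s * (r / 2)"
    using s[of "r / 2"] assms by (simp add: algebra_simps)
  finally have "s > 0"
    using assms by (simp add: zero_less_mult_iff)
  with s that show ?thesis by blast
qed

text \<open>
  Comparison with a parabola that violates the inequality of \<open>h\<close>, because \<open>b s\<^sup>2 < C\<close>. Suppose that \<open>h\<close>
  exceeds the parabola \<open>Q\<close> at some \<open>t\<close> near \<open>r\<close>. Tilting \<open>Q\<close> about \<open>r\<close> by a small slope \<open>\<eta>\<close>, upwards in the
  direction of \<open>t\<close>, keeps it below \<open>h\<close> at \<open>t\<close> and equal to \<open>h\<close> at \<open>r\<close>. Just next to \<open>r\<close>, however, the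
  tilted parabola is above the supporting line, hence above \<open>h\<close>. So it touches \<open>h\<close> from below, up to a
  vertical translation, at a point between \<open>r\<close> and \<open>t\<close>, where its slope is still close to \<open>- s\<close>.
\<close>

lemma h_below_parabola:
  assumes r: "0 < r" "r < d"
    and s: "s > 0" "\<And>t. t \<in> {0..d} \<Longrightarrow> h t \<le> h r - s * (t - r)"
    and b: "b > 0" "b * s\<^sup>2 < C"
  obtains \<delta> where "\<delta> > 0" "\<And>t. \<bar>t - r\<bar> < \<delta> \<Longrightarrow> h t \<le> h r - s * (t - r) - b / 2 * (t - r)\<^sup>2"
proof -
  have "((\<lambda>x. b * (s + x)\<^sup>2) \<longlongrightarrow> b * (s + 0)\<^sup>2) (at_right 0)"
    by (intro tendsto_intros)
  then have "\<forall>\<^sub>F x in at_right 0. b * (s + x)\<^sup>2 < C"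
    using b by (intro order_tendstoD(2)) auto
  then obtain \<delta>0 where \<delta>0: "\<delta>0 > 0" "b * (s + \<delta>0)\<^sup>2 < C"
    unfolding eventually_at_right_field
    by (metis dense)
  define \<delta> where "\<delta> = min (min r (d - r)) (\<delta>0 / (2 * b))"
  have "\<delta> \<le> \<delta>0 / (2 * b)" and \<delta>: "\<delta> > 0" "\<delta> \<le> r" "\<delta> \<le> d - r"
    using r b \<delta>0 by (auto simp: \<delta>_def)
  then have b\<delta>: "b * \<delta> \<le> \<delta>0 / 2"
    using b by (simp add: field_simps)
  show ?thesis
  proof (rule that[OF \<delta>(1)], rule ccontr)
    fix t assume t: "\<bar>t - r\<bar> < \<delta>"
    define Q where "Q x = h r - s * (x - r) - b / 2 * (x - r)\<^sup>2" for x
    assume "\<not> h t \<le> h r - s * (t - r) - b / 2 * (t - r)\<^sup>2"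
    then have gap: "h t - Q t > 0"
      by (simp add: Q_def)
    then have "t \<noteq> r"
      by (auto simp: Q_def)
    define k where "k = sgn (t - r)"
    define l where "l = \<bar>t - r\<bar>"
    have k: "k * k = 1" "\<bar>k\<bar> = 1" and tk: "t = r + k * l" and l: "0 < l" "l < \<delta>"
      using \<open>t \<noteq> r\<close> t by (auto simp: k_def l_def sgn_if)
    (* The tilt must spend at most half of the slack \<delta>0 of the slope, and must not close the gap at t. *)
    define \<eta> where "\<eta> = min (\<delta>0 / 2) ((h t - Q t) / l)"
    have \<eta>: "\<eta> > 0" "\<eta> \<le> \<delta>0 / 2" "\<eta> * l \<le> h t - Q t"
      using \<delta>0 gap l by (auto simp: \<eta>_def min_def field_simps)
    define q where "q x = Q x + \<eta> * k * (x - r)" for x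
    (* At distance w < 2 \<eta> / b from r the tilt outweighs the curvature of Q. *)
    define w where "w = min (l / 2) (\<eta> / b)"
    have w: "w > 0" "w < l" and "w \<le> \<eta> / b"
      using l \<eta>(1) b(1) by (simp_all add: w_def)
    then have bw: "b * w \<le> \<eta>"
      using b(1) by (simp add: pos_le_divide_eq mult.commute)
    define \<sigma> where "\<sigma> = r + k * w"
    have kk: "k * (k * x) = x" for x
      unfolding mult.assoc[symmetric] k(1) by simp
    have "(k * w)\<^sup>2 = w\<^sup>2"
      unfolding power_mult_distrib power2_eq_square[of k] k(1) by simp
    then have "q \<sigma> = h r - s * (\<sigma> - r) - b / 2 * w\<^sup>2 + \<eta> * w"
      unfolding q_def Q_def \<sigma>_def by (simp add: mult.assoc kk)
    moreover have "b / 2 * w\<^sup>2 < \<eta> * w"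
    proof -
      have "(b * w) * w < (2 * \<eta>) * w"
        using bw \<eta>(1) by (intro mult_strict_right_mono w(1)) linarith
      moreover have "b / 2 * w\<^sup>2 = (b * w) * w / 2"
        by (simp add: power2_eq_square)
      ultimately show ?thesis
        by linarith
    qed
    moreover have "\<bar>\<sigma> - r\<bar> = w"
      using k w by (simp add: \<sigma>_def abs_mult)
    then have "\<sigma> \<in> {0..d}"
      using w l \<delta> by auto
    ultimately have below: "h \<sigma> < q \<sigma>"
      using s(2)[of \<sigma>] by linarith
    have "q t = Q t + \<eta> * (k * (k * l))"
      by (simp add: q_def tk)
    then have "q t \<le> h t"
      unfolding kk using \<eta>(3) by linarith
    moreover have "q r = h r"
      by (simp add: q_def Q_def)
    ultimately have ends: "q (min r t) \<le> h (min r t)" "q (max r t) \<le> h (max r t)"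
      by (auto simp: min_def max_def)
    have \<sigma>_in: "\<sigma> \<in> {min r t<..<max r t}"
    proof (cases "t > r")
      case True
      then have "\<sigma> = r + w" "t = r + l"
        by (simp_all add: \<sigma>_def k_def l_def)
      then show ?thesis
        using w by simp
    next
      case False
      then have "\<sigma> = r - w" "t = r - l"
        using \<open>t \<noteq> r\<close> by (simp_all add: \<sigma>_def k_def l_def)
      then show ?thesis
        using w by simp
    qed
    have interval: "min r t < max r t" "0 \<le> min r t" "max r t \<le> d"
      using \<open>t \<noteq> r\<close> t \<delta> r by (auto simp: min_def max_def)
    have q_eq: "q x = (h r + s * r - b / 2 * r\<^sup>2 - \<eta> * k * r)
        + (\<eta> * k - s + b * r) * x + (- b) / 2 * x\<^sup>2" for x
      by (simp add: q_def Q_def field_simps power2_eq_square)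
    obtain \<tau> where \<tau>: "\<tau> \<in> {min r t<..<max r t}"
      "(\<eta> * k - s + b * r + (- b) * \<tau>)\<^sup>2 * (- b) \<le> - C"
      by (rule h_not_below_parabola[OF interval \<sigma>_in below ends q_eq])
    have "\<bar>\<tau> - r\<bar> \<le> \<delta>"
      using \<tau>(1) t by (auto simp: min_def max_def split: if_splits)
    then have "b * \<bar>\<tau> - r\<bar> \<le> \<delta>0 / 2"
      using b b\<delta> by (smt (verit) mult_left_mono)
    moreover have "\<bar>\<eta> * k\<bar> = \<eta>"
      using k \<eta> by (simp add: abs_mult)
    moreover have "\<bar>b * r + (- b) * \<tau>\<bar> = b * \<bar>\<tau> - r\<bar>"
      using b by (simp add: abs_mult_pos' flip: right_diff_distrib) (simp add: abs_mult abs_minus_commute)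
    ultimately have "\<bar>\<eta> * k - s + b * r + (- b) * \<tau>\<bar> \<le> s + \<delta>0"
      using \<eta> s(1) by linarith
    then have "(\<eta> * k - s + b * r + (- b) * \<tau>)\<^sup>2 \<le> (s + \<delta>0)\<^sup>2"
      using abs_le_square_iff s \<delta>0 by fastforce
    then have "b * (\<eta> * k - s + b * r + (- b) * \<tau>)\<^sup>2 \<le> b * (s + \<delta>0)\<^sup>2"
      using b by (intro mult_left_mono) auto
    with \<tau>(2) \<delta>0(2) show False
      by (simp add: mult.commute)
  qed
qed

end

section \<open>Comparison\<close>

text \<open>
  The heart of the argument. Since \<open>u x = M v y\<close> and \<open>u \<le> M v\<close> for pairs at distance at most \<open>2 r\<close>, the point
  \<open>y\<close> minimises \<open>v\<close> over the ball of radius \<open>r\<close> about \<open>c\<close>. Hence \<open>y\<close>, and with it the equidistant \<open>x\<close>, is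
  at distance exactly \<open>r\<close> from \<open>c\<close>, where the parabola above \<open>h\<close> yields a test function for \<open>u\<close>. The factor \<open>M\<close> multiplies both the slope
  and the curvature of the parabola, which accounts for the \<open>M\<^sup>3\<close> in the bound on \<open>Gu x\<close>.
\<close>

lemma no_touching_at_equidistant_points:
  fixes S :: "(real^'n::finite) set"
  assumes sub: "radial_subsolution S Gu u" and super: "radial_supersolution S Gv v"
    and r: "r > 0" and in_S: "cball c (2 * r) \<subseteq> S" and cont: "continuous_on (cball c (2 * r)) v"
    and M: "M > 0"
    and dom: "\<And>x y. x \<in> cball c (2 * r) \<Longrightarrow> y \<in> cball c (2 * r) \<Longrightarrow> dist x y \<le> 2 * r \<Longrightarrow> u x \<le> M * v y"
    and xy: "dist c x = dist c y" "dist c y \<le> r" "dist x y \<le> 2 * r" "u x = M * v y"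
    and P: "0 \<le> P" "P < C" "- (M ^ 3 * P) \<le> Gu x"
    and Gv: "\<And>z. z \<in> cball c (2 * r) \<Longrightarrow> Gv z \<le> - C"
  shows False
proof -
  interpret strict_radial_supersolution S Gv v c "2 * r" C
    using assms by unfold_locales auto
  have "v y \<le> v z" if "z \<in> cball c r" for z
  proof -
    have "dist x z \<le> 2 * r"
      using dist_triangle[of x z c] that xy by (simp add: dist_commute)
    then have "u x \<le> M * v z"
      using that xy r by (intro dom) auto
    then show ?thesis
      using xy M by simp
  qed
  then have hr: "h r = v y"
    using xy by (intro ball_min_eqI) auto
  then have "dist c y = r"
    using minimizer_on_sphere[of r y] xy r by auto
  then have dx: "dist c x = r" and "c \<noteq> x" and "x \<in> S"
    using xy r in_S by auto
  obtain s where s: "s > 0" "\<And>t. t \<in> {0..2 * r} \<Longrightarrow> h t \<le> h r - s * (t - r)"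
    using h_strict_decreasing_supergradient[of r] r by auto
  (* Halfway between P and C, so that b is admissible for v but too large for u. *)
  define b where "b = (P + C) / 2 / s\<^sup>2"
  have b: "b * s\<^sup>2 = (P + C) / 2"
    using s by (simp add: b_def)
  then have "b > 0" "b * s\<^sup>2 < C" "P < b * s\<^sup>2"
    using P s by (auto simp: b_def)
  then obtain \<delta> where \<delta>: "\<delta> > 0" "\<And>t. \<bar>t - r\<bar> < \<delta> \<Longrightarrow> h t \<le> h r - s * (t - r) - b / 2 * (t - r)\<^sup>2"
    using h_below_parabola[of r s b] s r by auto
  have "local_max_at S (\<lambda>x'. u x' - radial_parabola c x (M * s) (- (M * b)) x') x"
    unfolding local_max_at_def
  proof (intro conjI exI[of _ "min r \<delta>"] ballI)
    fix x' assume x': "x' \<in> S \<inter> ball x (min r \<delta>)"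
    define t where "t = 2 * r - dist c x'"
    have t: "\<bar>t - r\<bar> < \<delta>" "t \<in> {0..2 * r}"
      using x' dx dist_triangle[of c x' x] dist_triangle[of c x x'] by (auto simp: t_def dist_commute)
    obtain y' where y': "y' \<in> cball c t" "h t = v y'"
      using h_attained[OF t(2)] by blast
    have "dist c y' \<le> 2 * r"
      using y'(1) zero_le_dist[of c x'] by (simp add: t_def del: zero_le_dist)
    then have "u x' \<le> M * v y'"
      using y'(1) t(2) dist_triangle[of x' y' c] by (intro dom) (auto simp: t_def dist_commute)
    also have "\<dots> \<le> M * (h r - s * (t - r) - b / 2 * (t - r)\<^sup>2)"
      using \<delta>(2)[OF t(1)] M y'(2) by simp
    finally show "u x' - radial_parabola c x (M * s) (- (M * b)) x'
      \<le> u x - radial_parabola c x (M * s) (- (M * b)) x"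
      unfolding radial_parabola_def dx t_def using hr xy(4)
      by (simp add: algebra_simps power2_eq_square)
  qed (use r \<delta> \<open>x \<in> S\<close> in auto)
  then have "Gu x \<le> (M * s)\<^sup>2 * (- (M * b))"
    using sub \<open>c \<noteq> x\<close> unfolding radial_subsolution_def by blast
  then have "M ^ 3 * (b * s\<^sup>2) \<le> M ^ 3 * P"
    using P(3) by (simp add: algebra_simps power2_eq_square power3_eq_cube)
  then have "b * s\<^sup>2 \<le> P"
    using M by simp
  with \<open>P < b * s\<^sup>2\<close> show False by simp
qed

lemma compact_Collect_le:
  fixes f g :: "'a::t2_space \<Rightarrow> real"
  assumes "compact S" "continuous_on S f" "continuous_on S g"
  shows "compact {x \<in> S. f x \<le> g x}"
proof -
  have "compact (S \<inter> {x \<in> S. f x \<le> g x})"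
    using assms by (intro compact_Int_closed continuous_on_closed_Collect_le compact_imp_closed)
  then show ?thesis
    by (simp add: Int_def conj_ac)
qed

text \<open>
  On the diagonal \<open>x = y = z\<close> the right-hand side is larger, by at least some positive constant; uniform
  continuity extends this to neighbouring points.
\<close>

lemma uniform_gap_for_shifted_cube:
  fixes a v :: "'a::metric_space \<Rightarrow> real"
  assumes "compact K" "continuous_on K a" "continuous_on K v" "\<And>x. x \<in> K \<Longrightarrow> a x > 0" "\<And>x. x \<in> K \<Longrightarrow> v x > 0"
    and "\<epsilon> > 0"
  shows "\<exists>\<delta> \<kappa>. \<delta> > 0 \<and> \<kappa> > 0 \<and> (\<forall>x\<in>K. \<forall>y\<in>K. \<forall>z\<in>K. dist x y < \<delta> \<and> dist x z < \<delta> \<longrightarrow>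
           a x * v y ^ 3 + \<kappa> \<le> a z * (v z + \<epsilon>) ^ 3)"
proof (cases "K = {}")
  case False
  define f where "f p = a (snd (snd p)) * (v (snd (snd p)) + \<epsilon>) ^ 3 - a (fst p) * v (fst (snd p)) ^ 3" for p
  define g where "g x = a x * (v x + \<epsilon>) ^ 3 - a x * v x ^ 3" for x
  have "continuous_on K g"
    unfolding g_def using assms by (intro continuous_intros)
  then have "\<exists>x\<in>K. \<forall>x'\<in>K. g x \<le> g x'"
    by (intro continuous_attains_inf[OF \<open>compact K\<close> False])
  then obtain x0 where x0: "x0 \<in> K" "\<And>x. x \<in> K \<Longrightarrow> g x0 \<le> g x" by blast
  have "v x0 ^ 3 < (v x0 + \<epsilon>) ^ 3"
    using assms x0 by (intro power_strict_mono) (auto intro: less_imp_le)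
  then have pos: "g x0 > 0"
    using assms x0 by (simp add: g_def)
  have "continuous_on (K \<times> K \<times> K) f"
    unfolding f_def
    by (intro continuous_intros continuous_on_compose2[OF assms(2)] continuous_on_compose2[OF assms(3)]) auto
  then have "uniformly_continuous_on (K \<times> K \<times> K) f"
    using assms(1) by (intro compact_uniformly_continuous compact_Times)
  then obtain \<delta> where \<delta>: "\<delta> > 0"
    "\<And>p p'. p \<in> K \<times> K \<times> K \<Longrightarrow> p' \<in> K \<times> K \<times> K \<Longrightarrow> dist p' p < \<delta> \<Longrightarrow> dist (f p') (f p) < g x0 / 2"
    using pos unfolding uniformly_continuous_on_def by (meson half_gt_zero)
  have "a x * v y ^ 3 + g x0 / 2 \<le> a z * (v z + \<epsilon>) ^ 3"
    if K: "x \<in> K" "y \<in> K" "z \<in> K" and d: "dist x y < \<delta> / 2" "dist x z < \<delta> / 2" for x y z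
  proof -
    have "dist (x, y, z) (x, x, x) \<le> dist y x + dist z x"
      by (simp add: dist_Pair_Pair sqrt_sum_squares_le_sum)
    also have "\<dots> < \<delta>"
      using d by (simp add: dist_commute)
    finally have "dist (f (x, y, z)) (f (x, x, x)) < g x0 / 2"
      using K by (intro \<delta>) auto
    moreover have "f (x, x, x) = g x"
      by (simp add: f_def g_def)
    ultimately have "f (x, y, z) > g x - g x0 / 2"
      unfolding dist_real_def by linarith
    then show ?thesis
      using x0(2)[OF K(1)] by (simp add: f_def)
  qed
  then show ?thesis
    using \<delta>(1) pos by (intro exI[of _ "\<delta> / 2"] exI[of _ "g x0 / 2"]) auto
qed (auto intro: exI[of _ 1])

text \<open>
  It remains to find \<open>r\<close>. Every maximiser \<open>(xs, ys)\<close> of \<open>u x / V y\<close> over the pairs at distance at most \<open>2 r\<close>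
  satisfies \<open>u xs \<ge> M0 m\<close> with \<open>M0\<close> and \<open>m\<close> not depending on \<open>r\<close>. Thus \<open>xs\<close> lies in a fixed compact subset \<open>K\<close>
  of the domain, and a compact neighbourhood \<open>N\<close> of \<open>K\<close> contains all balls in question once \<open>r\<close> is small.
\<close>

lemma cubic_comparison_principle:
  fixes \<Omega> :: "(real^'n::finite) set"
  assumes \<Omega>: "open \<Omega>" "bounded \<Omega>" and a: "continuous_on \<Omega> a" "\<And>x. x \<in> \<Omega> \<Longrightarrow> a x > 0"
    and v: "continuous_on (closure \<Omega>) v" "\<And>x. x \<in> closure \<Omega> \<Longrightarrow> v x > 0"
      "radial_supersolution \<Omega> (\<lambda>x. - (a x * v x ^ 3)) v"
    and u: "continuous_on (closure \<Omega>) u" "\<And>x. x \<in> frontier \<Omega> \<Longrightarrow> u x \<le> 0"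
      "radial_subsolution \<Omega> (\<lambda>x. - (a x * u x ^ 3)) u"
    and "x \<in> \<Omega>"
  shows "u x \<le> 0"
proof (rule ccontr)
  assume "\<not> u x \<le> 0"
  have x: "x \<in> closure \<Omega>"
    using \<open>x \<in> \<Omega>\<close> closure_subset by blast
  have comp: "compact (closure \<Omega>)"
    using \<Omega> by simp
  have "\<exists>z\<in>closure \<Omega>. \<forall>z'\<in>closure \<Omega>. v z \<le> v z'"
    using x v comp by (intro continuous_attains_inf) auto
  then obtain z where z: "z \<in> closure \<Omega>" "\<And>z'. z' \<in> closure \<Omega> \<Longrightarrow> v z \<le> v z'" by blast
  define m where "m = v z / 2"
  have m: "m > 0"
    using v(2) z(1) by (simp add: m_def)
  (* Subtracting m makes the supersolution strict; subtracting half of the minimum keeps it positive. *)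
  define V where "V y = v y - m" for y
  have V: "V y \<ge> m" "V y > 0" if "y \<in> closure \<Omega>" for y
    using z(2)[OF that] m by (auto simp: V_def m_def)
  have cont_V: "continuous_on (closure \<Omega>) V"
    unfolding V_def using v by (intro continuous_intros)
  have super: "radial_supersolution \<Omega> (\<lambda>y. - (a y * (V y + m) ^ 3)) V"
    using v(3) unfolding radial_supersolution_def local_min_at_def V_def by simp
  define M0 where "M0 = u x / V x"
  have M0: "M0 > 0"
    using \<open>\<not> u x \<le> 0\<close> V(2)[OF x] by (simp add: M0_def)
  define K where "K = {y \<in> closure \<Omega>. M0 * m \<le> u y}"
  have "compact K"
    unfolding K_def by (intro compact_Collect_le comp u(1) continuous_on_const)
  have "K \<subseteq> \<Omega>"
    using u(2) mult_pos_pos[OF M0 m] closure_Un_frontier[of \<Omega>] unfolding K_def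
    by (smt (verit) UnE mem_Collect_eq subsetI)
  have "M0 * m \<le> u x"
    using mult_left_mono[OF V(1)[OF x], of M0] M0 V(2)[OF x] by (simp add: M0_def)
  then have "K \<noteq> {}"
    using x by (auto simp: K_def)
  obtain \<rho> where \<rho>: "\<rho> > 0" "\<And>y z. y \<in> K \<Longrightarrow> z \<notin> \<Omega> \<Longrightarrow> \<rho> \<le> dist y z"
  proof -
    have "closed (- \<Omega>)" "K \<inter> - \<Omega> = {}"
      using \<Omega>(1) \<open>K \<subseteq> \<Omega>\<close> by auto
    then have "\<exists>\<rho>>0. \<forall>y\<in>K. \<forall>z\<in>- \<Omega>. \<rho> \<le> dist y z"
      by (rule separate_compact_closed[OF \<open>compact K\<close>])
    then show ?thesis
      using that by (meson ComplI)
  qed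
  define N where "N = {y. infdist y K \<le> \<rho> / 2}"
  have "compact N"
    unfolding N_def using \<open>K \<noteq> {}\<close> \<open>compact K\<close> \<rho>(1) by (intro compact_infdist_le) auto
  have "N \<subseteq> \<Omega>"
  proof
    fix y assume "y \<in> N"
    obtain k where "k \<in> K" "infdist y K = dist y k"
      using infdist_attains_inf[OF compact_imp_closed[OF \<open>compact K\<close>] \<open>K \<noteq> {}\<close>] by metis
    then have "dist k y < \<rho>"
      using \<open>y \<in> N\<close> \<rho>(1) by (simp add: N_def dist_commute)
    then show "y \<in> \<Omega>"
      using \<rho>(2)[OF \<open>k \<in> K\<close>] by force
  qed
  then have "N \<subseteq> closure \<Omega>"
    using closure_subset by blast
  have "\<exists>\<delta> \<kappa>. \<delta> > 0 \<and> \<kappa> > 0 \<and> (\<forall>x\<in>N. \<forall>y\<in>N. \<forall>z\<in>N. dist x y < \<delta> \<and> dist x z < \<delta> \<longrightarrow>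
           a x * V y ^ 3 + \<kappa> \<le> a z * (V z + m) ^ 3)"
  proof (rule uniform_gap_for_shifted_cube[OF \<open>compact N\<close> _ _ _ _ m])
    show "continuous_on N a" "continuous_on N V"
      using \<open>N \<subseteq> \<Omega>\<close> \<open>N \<subseteq> closure \<Omega>\<close> continuous_on_subset[OF a(1)] continuous_on_subset[OF cont_V]
      by blast+
    show "a y > 0" "V y > 0" if "y \<in> N" for y
      using that a(2) V(2) \<open>N \<subseteq> \<Omega>\<close> \<open>N \<subseteq> closure \<Omega>\<close> by blast+
  qed
  then obtain \<delta> \<kappa> where \<delta>: "\<delta> > 0" and "\<kappa> > 0" and gap: "\<forall>x\<in>N. \<forall>y\<in>N. \<forall>z\<in>N.
      dist x y < \<delta> \<and> dist x z < \<delta> \<longrightarrow> a x * V y ^ 3 + \<kappa> \<le> a z * (V z + m) ^ 3"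
    by (elim exE conjE)
  (* The ball of radius 2 r about the midpoint has diameter 4 r, and its points have distance at
  most 3 r from xs. *)
  define r where "r = min (\<rho> / 8) (\<delta> / 8)"
  have r: "r > 0" "3 * r \<le> \<rho> / 2" "4 * r < \<delta>"
    using \<rho> \<delta> by (auto simp: r_def)
  define W where "W = {p \<in> closure \<Omega> \<times> closure \<Omega>. dist (fst p) (snd p) \<le> 2 * r}"
  have "compact W"
    unfolding W_def by (intro compact_Collect_le compact_Times comp continuous_intros)
  moreover have "(x, x) \<in> W"
    using x r by (simp add: W_def)
  moreover have "continuous_on W (\<lambda>p. u (fst p) / V (snd p))"
    using V(2) by (intro continuous_intros continuous_on_compose2[OF u(1)] continuous_on_compose2[OF cont_V])
      (force simp: W_def)+
  ultimately have "\<exists>p\<in>W. \<forall>p'\<in>W. u (fst p') / V (snd p') \<le> u (fst p) / V (snd p)"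
    by (intro continuous_attains_sup) auto
  then obtain xs ys where W: "(xs, ys) \<in> W" and max: "\<And>x y. (x, y) \<in> W \<Longrightarrow> u x / V y \<le> u xs / V ys"
    by force
  define M where "M = u xs / V ys"
  have cl: "xs \<in> closure \<Omega>" "ys \<in> closure \<Omega>" and dist_xs: "dist xs ys \<le> 2 * r"
    using W by (auto simp: W_def)
  have "M0 \<le> M"
    using max[OF \<open>(x, x) \<in> W\<close>] by (simp add: M_def M0_def)
  then have "M > 0"
    using M0 by simp
  have uM: "u xs = M * V ys"
    using V(2)[OF cl(2)] by (simp add: M_def)
  have "M0 * m \<le> u xs"
    unfolding uM using V[OF cl(2)] M0 m \<open>M0 \<le> M\<close> by (intro mult_mono) auto
  then have "xs \<in> K"
    using cl by (simp add: K_def)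
  define c where "c = midpoint xs ys"
  have dc: "dist c xs = dist xs ys / 2" "dist c ys = dist xs ys / 2"
    by (simp_all add: c_def dist_midpoint)
  have ball_N: "cball c (2 * r) \<subseteq> N"
  proof
    fix y assume "y \<in> cball c (2 * r)"
    then have "dist y xs \<le> \<rho> / 2"
      using dist_triangle[of y xs c] dc dist_xs r(2) by (simp add: dist_commute)
    then show "y \<in> N"
      unfolding N_def using infdist_le[OF \<open>xs \<in> K\<close>, of y] by simp
  qed
  have in_ball: "xs \<in> cball c (2 * r)" "ys \<in> cball c (2 * r)"
    using dc dist_xs r(1) by auto
  have close: "dist y z < \<delta>" if "y \<in> cball c (2 * r)" "z \<in> cball c (2 * r)" for y z
    using that dist_triangle[of y z c] r(3) by (simp add: dist_commute)
  show False
  proof (rule no_touching_at_equidistant_points[OF u(3) super r(1), of c M xs ys "a xs * V ys ^ 3" "a xs * V ys ^ 3 + \<kappa>"])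
    show "cball c (2 * r) \<subseteq> \<Omega>" "continuous_on (cball c (2 * r)) V"
      using ball_N \<open>N \<subseteq> \<Omega>\<close> \<open>N \<subseteq> closure \<Omega>\<close> continuous_on_subset[OF cont_V] by blast+
    show "u y \<le> M * V z" if "y \<in> cball c (2 * r)" "z \<in> cball c (2 * r)" "dist y z \<le> 2 * r" for y z
    proof -
      have "y \<in> closure \<Omega>" "z \<in> closure \<Omega>"
        using that ball_N \<open>N \<subseteq> closure \<Omega>\<close> by blast+
      then show ?thesis
        using max[of y z] that(3) V(2)[of z] by (simp add: W_def M_def[symmetric] pos_divide_le_eq)
    qed
    show "- (a z * (V z + m) ^ 3) \<le> - (a xs * V ys ^ 3 + \<kappa>)" if "z \<in> cball c (2 * r)" for z
    proof -
      have "xs \<in> N" "ys \<in> N" "z \<in> N"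
        using in_ball that ball_N by blast+
      moreover have "dist xs ys < \<delta>" "dist xs z < \<delta>"
        using close in_ball that by blast+
      ultimately have "a xs * V ys ^ 3 + \<kappa> \<le> a z * (V z + m) ^ 3"
        using gap by blast
      then show ?thesis by simp
    qed
    have "a xs > 0"
      using a(2) \<open>xs \<in> K\<close> \<open>K \<subseteq> \<Omega>\<close> by blast
    then show "0 \<le> a xs * V ys ^ 3"
      using V(2)[OF cl(2)] by simp
    show "- (M ^ 3 * (a xs * V ys ^ 3)) \<le> - (a xs * u xs ^ 3)"
      by (simp add: uM power_mult_distrib algebra_simps)
  qed (use \<open>M > 0\<close> \<open>\<kappa> > 0\<close> dc dist_xs uM in auto)
qed

theorem lemma3p7:
  fixes \<Omega> :: "(real^'n::finite) set"
    and a v u :: "real^'n \<Rightarrow> real"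
    and lam :: real
  assumes "CARD('n) \<ge> 2"
    and "open \<Omega>" and "connected \<Omega>" and "\<Omega> \<noteq> {}" and "bounded \<Omega>"
    and "continuous_on \<Omega> a" and "Linfty_on \<Omega> a" and "\<forall>x\<in>\<Omega>. a x > 0"
    and "lam > 0"
    and "continuous_on (closure \<Omega>) v" and "\<forall>x\<in>\<Omega>. v x > 0"
    and "viscosity_supersolution \<Omega> (\<lambda>x t. - lam * a x * t ^ 3) v"
    and "(INF x\<in>frontier \<Omega>. v x) > 0"
    and "continuous_on (closure \<Omega>) u" and "\<forall>x\<in>frontier \<Omega>. u x = 0"
  shows "(viscosity_subsolution \<Omega> (\<lambda>x t. - lam * a x * t ^ 3) u \<longrightarrow> (\<forall>x\<in>\<Omega>. u x \<le> 0)) \<and>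
         (viscosity_solution \<Omega> (\<lambda>x t. - lam * a x * t ^ 3) u \<longrightarrow> (\<forall>x\<in>\<Omega>. u x = 0))"
proof -
  have cont_a: "continuous_on \<Omega> (\<lambda>x. lam * a x)"
    by (intro continuous_on_mult continuous_on_const assms(6))
  have a_pos: "lam * a x > 0" if "x \<in> \<Omega>" for x
    using assms(8,9) that by simp
  (* Continuity and compactness of the boundary make the infimum a genuine lower bound there. *)
  have v_pos: "v x > 0" if "x \<in> closure \<Omega>" for x
  proof (cases "x \<in> \<Omega>")
    case False
    then have "x \<in> frontier \<Omega>"
      using that \<open>open \<Omega>\<close> by (simp add: frontier_def interior_open)
    have "compact (v ` frontier \<Omega>)"
      by (intro compact_continuous_image continuous_on_subset[OF assms(10)] compact_frontier_bounded assms(5))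
        (auto simp: frontier_def)
    then have "(INF x\<in>frontier \<Omega>. v x) \<le> v x"
      using \<open>x \<in> frontier \<Omega>\<close> by (intro cINF_lower bounded_imp_bdd_below compact_imp_bounded)
    with assms(13) show ?thesis by simp
  qed (use assms(11) in blast)
  have super: "radial_supersolution \<Omega> (\<lambda>x. - (lam * a x * v x ^ 3)) v"
    using viscosity_supersolution_imp_radial[OF assms(12)] by simp
  have nonpos: "w x \<le> 0" if "continuous_on (closure \<Omega>) w" "\<And>x. x \<in> frontier \<Omega> \<Longrightarrow> w x \<le> 0"
      "radial_subsolution \<Omega> (\<lambda>x. - (lam * a x * w x ^ 3)) w" "x \<in> \<Omega>" for w x
    using cubic_comparison_principle[OF assms(2,5) cont_a a_pos assms(10) v_pos super that] .
  have sub: "u x \<le> 0" if "viscosity_subsolution \<Omega> (\<lambda>x t. - lam * a x * t ^ 3) u" "x \<in> \<Omega>" for x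
  proof (rule nonpos[OF assms(14) _ _ that(2)])
    show "radial_subsolution \<Omega> (\<lambda>x. - (lam * a x * u x ^ 3)) u"
      using viscosity_subsolution_imp_radial[OF that(1)] by simp
  qed (simp add: assms(15))
  have super_u: "- u x \<le> 0" if "viscosity_supersolution \<Omega> (\<lambda>x t. - lam * a x * t ^ 3) u" "x \<in> \<Omega>" for x
  proof (rule nonpos[OF continuous_on_minus[OF assms(14)] _ _ that(2)])
    have "radial_supersolution \<Omega> (\<lambda>x. - lam * a x * u x ^ 3) u"
      by (rule viscosity_supersolution_imp_radial[OF that(1)])
    then show "radial_subsolution \<Omega> (\<lambda>x. - (lam * a x * (- u x) ^ 3)) (\<lambda>x. - u x)"
      by (simp flip: radial_subsolution_uminus)
  qed (simp add: assms(15))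
  show ?thesis
    unfolding viscosity_solution_def
    using sub super_u by (meson antisym neg_le_0_iff_le)
qed

end
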